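(* Let $n\ge 1$ be an integer, let $l_1\gg l_2\gg\dots\gg l_n>0$ be real numbers, let $P=\{x\in\mathbb{R}^n : l_1x_1+\dots+l_nx_n=1\}$, and let $\mathcal{B}_n$ be the arrangement in $\mathbb{R}^n$ of the hyperplanes $\{x_i=0\}$ ($1\le i\le n$), $\{x_i+x_j=0\}$ and $\{x_i-x_j=0\}$ ($1\le i<j\le n$). The following four sets are in bijection (i.e. they are finite and have the same cardinality): (1) The set of bounded regions of $\mathcal{B}_n\cap P$ in $P$. (2) The set of signed permutations of $[n]$ all of whose left-to-right minima have positive signs. (3) The set of build-tree codes of length $n$. (4) The set of increasingly labeled trees with $n+1$ vertices. Moreover, the common cardinality of these sets equals $(2n-1)!!=1\cdot3\cdot5\cdots(2n-1)$.
   Context: Notation: $[n]=\{1,2,\dots,n\}$. The condition $l_1\gg l_2\gg\dots\gg l_n>0$ ("far greater than") is taken to mean $l_n>0$ and $l_i>l_{i+1}+l_{i+2}+\dots+l_n$ for every $1\le i\le n-1$. Regions: $\mathcal{B}_n\cap P=\{H\cap P: H\in\mathcal{B}_n\}$, an arrangement in the affine space $P$. Its regions are the connected components of $P\setminus\bigcup_{H\in\mathcal{B}_n}H$. Signed permutation of $[n]$: a permutation $(a_1,\dots,a_n)$ of $[n]$ together with a map $\sigma\colon[n]\to\{\pm1\}$; $\sigma(i)$ is the sign of $i$. Its left-to-right minima are $m_i=\min(a_1,\dots,a_i)$, $1\le i\le n$; the sign of $m_i$ is $\sigma(m_i)$. Build-tree code of length $n$: a sequence $c_1c_2\cdots c_n$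 of pairs $c_i=(a_i,\sigma_i)$ with integers $0\le a_i\le i-1$ and $\sigma_i\in\{\pm1\}$ such that $(a_i,\sigma_i)\ne(0,-1)$. Rooted plane tree: a finite rooted tree in which the children of each vertex are linearly ordered from left to right. Increasingly labeled tree with $n+1$ vertices: a rooted plane tree $T$ with $n+1$ vertices together with a bijection $\lambda$ from its vertices to $\{0,1,\dots,n\}$ such that $\lambda(u)>\lambda(v)$ whenever $u$ is a child of $v$; considered up to label-preserving isomorphism of rooted plane trees. *)

theory Defs
  imports "HOL-Analysis.Analysis" "HOL-Combinatorics.Permutations"
begin

text \<open>
  Coordinates of \<open>\<real>\<^sup>n\<close> are indexed by an arbitrary finite linearly ordered type \<open>'n\<close> with
  \<open>n = CARD('n)\<close>; its \<open>k\<close>-th smallest element plays the role of the index \<open>k\<close>, so that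
  \<open>Max UNIV\<close> is the index \<open>n\<close>.
\<close>

definition far_decreasing :: "real ^ 'n::{finite,linorder} \<Rightarrow> bool" where
  "far_decreasing l \<longleftrightarrow>
     l $ Max UNIV > 0 \<and> (\<forall>i < Max UNIV. l $ i > (\<Sum>j\<in>{i<..}. l $ j))"

definition slice :: "real ^ 'n::finite \<Rightarrow> (real ^ 'n) set" where
  "slice l = {x. (\<Sum>i\<in>UNIV. l $ i * x $ i) = 1}"

definition type_B_arrangement :: "(real ^ 'n::{finite,linorder}) set set" where
  "type_B_arrangement =
     {{x. x $ i = 0} | i. True} \<union>
     {{x. x $ i + x $ j = 0} | i j. i < j} \<union>
     {{x. x $ i - x $ j = 0} | i j. i < j}"

definition restricted_arrangement :: "'a set set \<Rightarrow> 'a set \<Rightarrow> 'a set set" where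
  "restricted_arrangement \<A> P = (\<lambda>H. H \<inter> P) ` \<A>"

definition regions :: "'a::topological_space set \<Rightarrow> 'a set set \<Rightarrow> 'a set set" where
  "regions P \<A> = components (P - \<Union>\<A>)"

definition bounded_regions :: "'a::metric_space set \<Rightarrow> 'a set set \<Rightarrow> 'a set set" where
  "bounded_regions P \<A> = {R \<in> regions P \<A>. bounded R}"

definition signed_permutations :: "nat \<Rightarrow> ((nat \<Rightarrow> nat) \<times> (nat \<Rightarrow> int)) set" where
  "signed_permutations n = {a. a permutes {1..n}} \<times> ({1..n} \<rightarrow>\<^sub>E {1, -1})"

definition left_to_right_min :: "(nat \<Rightarrow> nat) \<Rightarrow> nat \<Rightarrow> nat" where
  "left_to_right_min a i = Min (a ` {1..i})"

definition positive_minima_signed_permutations ::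
    "nat \<Rightarrow> ((nat \<Rightarrow> nat) \<times> (nat \<Rightarrow> int)) set" where
  "positive_minima_signed_permutations n =
     {(a, \<sigma>) \<in> signed_permutations n. \<forall>i\<in>{1..n}. \<sigma> (left_to_right_min a i) = 1}"

definition build_tree_codes :: "nat \<Rightarrow> (nat \<Rightarrow> nat \<times> int) set" where
  "build_tree_codes n = (\<Pi>\<^sub>E i\<in>{1..n}. {0..i - 1} \<times> {1, -1} - {(0, -1)})"

text \<open>
  Two labeled rooted plane trees are equal in this datatype iff they are isomorphic by a
  label-preserving isomorphism, so its elements represent the isomorphism classes.
\<close>

datatype 'a plane_tree = Node (root_label: 'a) (children: "'a plane_tree list")

text \<open>One entry for each vertex.\<close>

primrec vertex_labels :: "'a plane_tree \<Rightarrow> 'a list" where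
  "vertex_labels (Node v ts) = v # concat (map vertex_labels ts)"

fun increasing :: "'a::ord plane_tree \<Rightarrow> bool" where
  "increasing (Node v ts) \<longleftrightarrow> (\<forall>t\<in>set ts. root_label t > v \<and> increasing t)"

definition increasing_trees :: "nat \<Rightarrow> nat plane_tree set" where
  "increasing_trees n =
     {t. length (vertex_labels t) = n + 1 \<and> distinct (vertex_labels t) \<and>
         set (vertex_labels t) = {0..n} \<and> increasing t}"

end

theory Submission
  imports Defs
begin

text \<open>
  Each of the four sets is built up by \<open>n\<close> independent choices, the \<open>i\<close>-th one with \<open>2 * i - 1\<close>
  possibilities.

  For the codes the \<open>i\<close>-th choice is the entry \<open>c\<^sub>i\<close>. For signed permutations, the last entry of an
  arrangement of \<open>i\<close> distinct numbers is a left-to-right minimum exactly if it is the smallest of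
  them; so it must be positive in one case and has a free sign in the other \<open>i - 1\<close> cases, and it does
  not affect the minima before it. For trees, the vertex with the largest label is a leaf, and
  a plane tree with \<open>i\<close> vertices offers \<open>d + 1\<close> places for a new leaf below each vertex with \<open>d\<close>
  children, altogether \<open>(i - 1) + i\<close>.

  The bounded regions are matched with the signed permutations. The complement of the arrangement
  splits into the chambers
  \<open>\<sigma>(a\<^sub>1) x(a\<^sub>1) > \<sigma>(a\<^sub>2) x(a\<^sub>2) > \<dots> > \<sigma>(a\<^sub>n) x(a\<^sub>n) > 0\<close>, one for each signed permutation, and each is a
  convex cone whose extreme rays are the vectors \<open>r\<^sub>k\<close> with \<open>\<sigma>(a\<^sub>i) r\<^sub>k(a\<^sub>i)\<close> equal to \<open>1\<close> for \<open>i \<le> k\<close>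
  and to \<open>0\<close> for \<open>i > k\<close>. The slice meets such a cone in a nonempty bounded set iff the
  linear form \<open>l\<close> is positive on all the rays (\<open>bounded_chamber_slice\<close>, \<open>unbounded_chamber_slice\<close>).
  Its value on \<open>r\<^sub>k\<close> is \<open>\<sigma>(a\<^sub>1) l(a\<^sub>1) + \<dots> + \<sigma>(a\<^sub>k) l(a\<^sub>k)\<close>, and since the coefficients
  decrease so fast, the smallest index involved decides the sign of this sum
  (\<open>far_decreasing_signed_sum\<close>). So the condition is that the left-to-right minima are positive.
\<close>

section \<open>Build-tree codes\<close>

lemma card_build_tree_codes:
  "finite (build_tree_codes n) \<and> card (build_tree_codes n) = (\<Prod>i = 1..n. 2 * i - 1)"
proof -
  have "card ({0..i - 1} \<times> {1, -1} - {(0, -1)} :: (nat \<times> int) set) = 2 * i - 1"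
    if "i \<in> {1..n}" for i
    using that by (subst card_Diff_singleton) (auto simp: card_cartesian_product)
  then show ?thesis
    unfolding build_tree_codes_def by (auto simp: card_PiE intro!: finite_PiE prod.cong)
qed

section \<open>Signed permutations with positive left-to-right minima\<close>

text \<open>
  Arbitrary finite sets \<open>V\<close> of values are allowed so that deleting an entry needs no relabelling. The
  values of \<open>a\<close> outside \<open>{1..n}\<close> follow the convention for permutations of \<open>{1..n}\<close>.
\<close>

definition positive_minima_arrangements :: "nat \<Rightarrow> nat set \<Rightarrow> ((nat \<Rightarrow> nat) \<times> (nat \<Rightarrow> int)) set" where
  "positive_minima_arrangements n V =
     {(a, \<sigma>). bij_betw a {1..n} V \<and> (\<forall>i. i \<notin> {1..n} \<longrightarrow> a i = i) \<and> \<sigma> \<in> V \<rightarrow>\<^sub>E {1, -1} \<and>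
        (\<forall>i\<in>{1..n}. \<sigma> (left_to_right_min a i) = 1)}"

lemma positive_minima_signed_permutations_eq:
  "positive_minima_signed_permutations n = positive_minima_arrangements n {1..n}"
proof -
  have "a permutes {1..n} \<longleftrightarrow> bij_betw a {1..n} {1..n} \<and> (\<forall>i. i \<notin> {1..n} \<longrightarrow> a i = i)"
    for a :: "nat \<Rightarrow> nat"
    using bij_imp_permutes permutes_imp_bij permutes_not_in by metis
  then show ?thesis
    unfolding positive_minima_signed_permutations_def positive_minima_arrangements_def
      signed_permutations_def by auto
qed

text \<open>
  The signs that the last entry \<open>v\<close> of an arrangement of \<open>V\<close> may carry.
\<close>

definition last_signs :: "nat set \<Rightarrow> nat \<Rightarrow> int set" where
  "last_signs V v = (if v = Min V then {1} else {1, -1})"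

lemma left_to_right_min_upd_later:
  "i \<le> n \<Longrightarrow> left_to_right_min (a(Suc n := v)) i = left_to_right_min a i"
  unfolding left_to_right_min_def by (intro arg_cong[where f = Min] image_cong) auto

lemma left_to_right_min_last:
  "bij_betw a {1..n} V \<Longrightarrow> left_to_right_min a n = Min V"
  unfolding left_to_right_min_def by (simp add: bij_betw_def)

lemma left_to_right_min_in:
  "bij_betw a {1..n} V \<Longrightarrow> i \<in> {1..n} \<Longrightarrow> left_to_right_min a i \<in> V"
proof -
  assume a: "bij_betw a {1..n} V" "i \<in> {1..n}"
  then have "Min (a ` {1..i}) \<in> a ` {1..i}" by (intro Min_in) auto
  also have "\<dots> \<subseteq> V" using a by (auto simp: bij_betw_def)
  finally show ?thesis by (simp add: left_to_right_min_def)
qed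

text \<open>
  The minima over the first \<open>n\<close> positions do not see the new entry \<open>v\<close>, and the minimum over all
  positions is \<open>Min V\<close>. If \<open>v \<noteq> Min V\<close>, then \<open>Min V\<close> was already the last minimum before, and its
  sign is positive.
\<close>

lemma append_entry:
  assumes fin: "finite V" and v: "v \<in> V" and s: "s \<in> last_signs V v"
    and w: "(a, \<sigma>) \<in> positive_minima_arrangements n (V - {v})"
  shows "(a(Suc n := v), \<sigma>(v := s)) \<in> positive_minima_arrangements (Suc n) V"
proof -
  have bij: "bij_betw a {1..n} (V - {v})" and out: "\<And>i. i \<notin> {1..n} \<Longrightarrow> a i = i"
    and \<sigma>: "\<sigma> \<in> V - {v} \<rightarrow>\<^sub>E {1, -1}" and pos: "\<And>i. i \<in> {1..n} \<Longrightarrow> \<sigma> (left_to_right_min a i) = 1"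
    using w by (auto simp: positive_minima_arrangements_def)
  have bij': "bij_betw (a(Suc n := v)) {1..Suc n} V"
  proof -
    have "bij_betw (a(Suc n := v)) {1..n} (V - {v})"
      using bij by (rule bij_betw_cong[THEN iffD1, rotated]) auto
    then have "bij_betw (a(Suc n := v)) ({1..n} \<union> {Suc n}) ((V - {v}) \<union> {v})"
      by (rule bij_betw_combine) (auto simp: bij_betw_def)
    moreover have "{1..n} \<union> {Suc n} = {1..Suc n}" "(V - {v}) \<union> {v} = V"
      using v by auto
    ultimately show ?thesis by simp
  qed
  have \<sigma>': "\<sigma>(v := s) \<in> V \<rightarrow>\<^sub>E {1, -1}"
    using \<sigma> s v by (auto simp: PiE_def Pi_def extensional_def last_signs_def split: if_splits)
  have "(\<sigma>(v := s)) (left_to_right_min (a(Suc n := v)) i) = 1" if i: "i \<in> {1..Suc n}" for i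
  proof (cases "i = Suc n")
    case True
    have eq: "left_to_right_min (a(Suc n := v)) i = Min V"
      using bij' True left_to_right_min_last by blast
    show ?thesis
    proof (cases "v = Min V")
      case True
      then show ?thesis using s eq by (simp add: last_signs_def)
    next
      case False
      have "Min V \<in> V - {v}"
        using False v fin Min_in by blast
      then have ne: "V - {v} \<noteq> {}" and mn: "Min (V - {v}) = Min V"
        using fin by (auto intro!: Min_eqI)
      then have "n \<noteq> 0" using bij by (auto simp: bij_betw_def)
      then have "\<sigma> (Min (V - {v})) = 1"
        using pos[of n] left_to_right_min_last[OF bij] by simp
      then show ?thesis using eq mn False by simp
    qed
  next
    case False
    then have "i \<in> {1..n}" using i by auto
    then show ?thesis
      using left_to_right_min_in[OF bij] pos by (force simp: left_to_right_min_upd_later)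
  qed
  then show ?thesis
    using bij' \<sigma>' out by (auto simp: positive_minima_arrangements_def)
qed

lemma remove_last_entry:
  assumes fin: "finite V"
    and w: "(a, \<sigma>) \<in> positive_minima_arrangements (Suc n) V"
  defines "v \<equiv> a (Suc n)"
  shows "v \<in> V" and "\<sigma> v \<in> last_signs V v"
    and "(a(Suc n := Suc n), \<sigma>(v := undefined)) \<in> positive_minima_arrangements n (V - {v})"
proof -
  have bij: "bij_betw a {1..Suc n} V" and out: "\<And>i. i \<notin> {1..Suc n} \<Longrightarrow> a i = i"
    and \<sigma>: "\<sigma> \<in> V \<rightarrow>\<^sub>E {1, -1}" and pos: "\<And>i. i \<in> {1..Suc n} \<Longrightarrow> \<sigma> (left_to_right_min a i) = 1"
    using w by (auto simp: positive_minima_arrangements_def)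
  show v: "v \<in> V" using bij by (auto simp: v_def bij_betw_def)
  have "\<sigma> (Min V) = 1"
    using pos[of "Suc n"] left_to_right_min_last[OF bij] by simp
  then show "\<sigma> v \<in> last_signs V v"
    using \<sigma> v by (auto simp: last_signs_def PiE_iff)
  have "bij_betw a ({1..Suc n} - {Suc n}) (V - {v})"
    unfolding v_def using bij by (intro bij_betw_DiffI) (auto simp: bij_betw_def)
  moreover have "{1..Suc n} - {Suc n} = {1..n}" by auto
  ultimately have bij0: "bij_betw a {1..n} (V - {v})" by simp
  have bij': "bij_betw (a(Suc n := Suc n)) {1..n} (V - {v})"
    using bij0 by (rule bij_betw_cong[THEN iffD1, rotated]) auto
  have "(\<sigma>(v := undefined)) (left_to_right_min (a(Suc n := Suc n)) i) = 1" if i: "i \<in> {1..n}" for i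
    using left_to_right_min_in[OF bij0 i] pos[of i] i by (auto simp: left_to_right_min_upd_later)
  then show "(a(Suc n := Suc n), \<sigma>(v := undefined)) \<in> positive_minima_arrangements n (V - {v})"
    using bij' \<sigma> out by (auto simp: positive_minima_arrangements_def PiE_iff extensional_def)
qed

text \<open>
  Splitting off the last entry gives \<open>1 + 2 * n\<close> choices for it with its sign, and the same problem
  for the remaining \<open>n\<close> values.
\<close>

lemma card_positive_minima_arrangements:
  assumes "finite V" and "card V = n"
  shows "finite (positive_minima_arrangements n V) \<and>
    card (positive_minima_arrangements n V) = (\<Prod>i = 1..n. 2 * i - 1)"
  using assms
proof (induction n arbitrary: V)
  case 0
  have "positive_minima_arrangements 0 V = {(id, \<lambda>_. undefined)}"
    using 0 by (auto simp: positive_minima_arrangements_def bij_betw_def)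
  then show ?case by simp
next
  case (Suc n)
  let ?D = "SIGMA v:V. last_signs V v \<times> positive_minima_arrangements n (V - {v})"
  have IH: "finite (positive_minima_arrangements n (V - {v}))"
    "card (positive_minima_arrangements n (V - {v})) = (\<Prod>i = 1..n. 2 * i - 1)" if "v \<in> V" for v
    using Suc.IH[of "V - {v}"] Suc.prems that by auto
  have bij: "bij_betw (\<lambda>(v, s, a, \<sigma>). (a(Suc n := v), \<sigma>(v := s))) ?D
      (positive_minima_arrangements (Suc n) V)"
  proof (rule bij_betw_byWitness[where
        f' = "\<lambda>(a, \<sigma>). (a (Suc n), \<sigma> (a (Suc n)), a(Suc n := Suc n), \<sigma>(a (Suc n) := undefined))"])
    show "\<forall>d\<in>?D. (\<lambda>(a, \<sigma>). (a (Suc n), \<sigma> (a (Suc n)), a(Suc n := Suc n), \<sigma>(a (Suc n) := undefined)))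
        ((\<lambda>(v, s, a, \<sigma>). (a(Suc n := v), \<sigma>(v := s))) d) = d"
      by (auto simp: positive_minima_arrangements_def fun_eq_iff PiE_iff extensional_def)
    show "\<forall>w\<in>positive_minima_arrangements (Suc n) V. (\<lambda>(v, s, a, \<sigma>). (a(Suc n := v), \<sigma>(v := s)))
        ((\<lambda>(a, \<sigma>). (a (Suc n), \<sigma> (a (Suc n)), a(Suc n := Suc n), \<sigma>(a (Suc n) := undefined))) w) = w"
      by auto
    show "(\<lambda>(v, s, a, \<sigma>). (a(Suc n := v), \<sigma>(v := s))) ` ?D \<subseteq> positive_minima_arrangements (Suc n) V"
      using append_entry[OF Suc.prems(1)] by auto
    show "(\<lambda>(a, \<sigma>). (a (Suc n), \<sigma> (a (Suc n)), a(Suc n := Suc n), \<sigma>(a (Suc n) := undefined))) `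
        positive_minima_arrangements (Suc n) V \<subseteq> ?D"
      using remove_last_entry[OF Suc.prems(1)] by auto
  qed
  have "finite ?D"
    using Suc.prems IH by (intro finite_SigmaI finite_cartesian_product) (auto simp: last_signs_def)
  moreover have "card ?D = (\<Prod>i = 1..Suc n. 2 * i - 1)"
  proof -
    have "card ?D = (\<Sum>v\<in>V. card (last_signs V v) * (\<Prod>i = 1..n. 2 * i - 1))"
      using Suc.prems IH
      by (subst card_SigmaI) (auto simp: last_signs_def card_cartesian_product intro!: sum.cong)
    also have "\<dots> = (\<Sum>v\<in>V. card (last_signs V v)) * (\<Prod>i = 1..n. 2 * i - 1)"
      by (simp add: sum_distrib_right)
    also have "(\<Sum>v\<in>V. card (last_signs V v)) = 1 + 2 * card (V - {Min V})"
    proof -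
      have V: "V \<noteq> {}" using Suc.prems by auto
      have "(\<Sum>v\<in>V. card (last_signs V v)) =
          card (last_signs V (Min V)) + (\<Sum>v\<in>V - {Min V}. card (last_signs V v))"
        using Suc.prems V by (intro sum.remove) auto
      also have "(\<Sum>v\<in>V - {Min V}. card (last_signs V v)) = (\<Sum>v\<in>V - {Min V}. 2)"
        by (intro sum.cong) (auto simp: last_signs_def)
      finally show ?thesis by (simp add: last_signs_def)
    qed
    also have "card (V - {Min V}) = n"
      using Suc.prems by (subst card_Diff_singleton) (auto intro!: Min_in)
    finally show ?thesis by simp
  qed
  ultimately show ?case
    unfolding bij_betw_finite[OF bij, symmetric] bij_betw_same_card[OF bij, symmetric] by (rule conjI)
qed

section \<open>Increasing plane trees\<close>

text \<open>
  Trees are treated as forests, that is, lists of trees: the children of the root form a forest, and a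
  nonempty forest consists of a vertex together with two smaller forests, namely its children and the
  trees to its right. Recursion along these two parts replaces the nested recursion on trees.
\<close>

abbreviation forest_labels :: "'a plane_tree list \<Rightarrow> 'a list" where
  "forest_labels ts \<equiv> concat (map vertex_labels ts)"

fun increasing_forest :: "nat plane_tree list \<Rightarrow> bool" where
  "increasing_forest [] \<longleftrightarrow> True"
| "increasing_forest (Node v ts # us) \<longleftrightarrow>
     (\<forall>u\<in>set (forest_labels ts). v < u) \<and> increasing_forest ts \<and> increasing_forest us"

text \<open>
  A new leaf can be put in front of the first tree, below its root, or somewhere behind it. A place
  between two consecutive siblings is thus counted once, as being in front of the right one.
\<close>

fun leaf_insertions :: "nat \<Rightarrow> nat plane_tree list \<Rightarrow> nat plane_tree list set" where
  "leaf_insertions x [] = {[Node x []]}"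
| "leaf_insertions x (Node v ts # us) =
     {Node x [] # Node v ts # us} \<union>
     (\<lambda>ts'. Node v ts' # us) ` leaf_insertions x ts \<union>
     (\<lambda>us'. Node v ts # us') ` leaf_insertions x us"

text \<open>
  The children of \<open>x\<close> are dropped along with it, so this removes a single vertex only if \<open>x\<close> is
  a leaf, as is the vertex with the largest label in an increasing forest.
\<close>

fun remove_leaf :: "nat \<Rightarrow> nat plane_tree list \<Rightarrow> nat plane_tree list" where
  "remove_leaf x [] = []"
| "remove_leaf x (Node v ts # us) =
     (if v = x then us else Node v (remove_leaf x ts) # remove_leaf x us)"

lemma increasing_forest_Cons:
  "increasing_forest (t # us) \<longleftrightarrow> increasing_forest [t] \<and> increasing_forest us"
  by (cases t) auto

lemma increasing_iff_increasing_forest: "increasing t \<longleftrightarrow> increasing_forest [t]"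
proof (induction t)
  case (Node v ts)
  have forest: "(\<forall>t\<in>set us. increasing t) \<longleftrightarrow> increasing_forest us" if "set us \<subseteq> set ts" for us
    using that
  proof (induction us)
    case (Cons t us)
    then show ?case
      using Node.IH[of t] by (subst increasing_forest_Cons) auto
  qed simp
  have root: "root_label t \<in> set (vertex_labels t)" for t :: "nat plane_tree"
    by (cases t) auto
  have above: "root_label t \<le> u" if "increasing t" "u \<in> set (vertex_labels t)" "t \<in> set ts" for t u
  proof (cases t)
    case t: (Node w ws)
    show ?thesis using that Node.IH[OF \<open>t \<in> set ts\<close>] t by (auto intro: less_imp_le)
  qed
  have "(\<forall>t\<in>set ts. v < root_label t) \<longleftrightarrow> (\<forall>u\<in>set (forest_labels ts). v < u)"
    if "\<forall>t\<in>set ts. increasing t"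
  proof
    assume "\<forall>t\<in>set ts. v < root_label t"
    then show "\<forall>u\<in>set (forest_labels ts). v < u"
      using above that by (auto intro: less_le_trans)
  next
    assume "\<forall>u\<in>set (forest_labels ts). v < u"
    then show "\<forall>t\<in>set ts. v < root_label t"
      using root by auto
  qed
  then show ?case
    using forest[of ts] by auto
qed

lemma remove_leaf_notin: "x \<notin> set (forest_labels f) \<Longrightarrow> remove_leaf x f = f"
  by (induction x f rule: remove_leaf.induct) auto

lemma leaf_insertion_labels:
  "g \<in> leaf_insertions x f \<Longrightarrow> mset (forest_labels g) = add_mset x (mset (forest_labels f))"
  by (induction x f arbitrary: g rule: leaf_insertions.induct) auto

lemma leaf_insertion_set_labels:
  "g \<in> leaf_insertions x f \<Longrightarrow> set (forest_labels g) = insert x (set (forest_labels f))"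
  using leaf_insertion_labels[of g x f] by (metis set_mset_add_mset_insert set_mset_mset)

lemma leaf_insertion_increasing:
  "g \<in> leaf_insertions x f \<Longrightarrow> increasing_forest f \<Longrightarrow> \<forall>u\<in>set (forest_labels f). u < x \<Longrightarrow>
   increasing_forest g"
proof (induction x f arbitrary: g rule: leaf_insertions.induct)
  case (2 x v ts us)
  then show ?case
    by (auto simp: leaf_insertion_set_labels simp del: set_concat)
qed simp

lemma remove_inserted_leaf:
  "g \<in> leaf_insertions x f \<Longrightarrow> x \<notin> set (forest_labels f) \<Longrightarrow> remove_leaf x g = f"
proof (induction x f arbitrary: g rule: leaf_insertions.induct)
  case (2 x v ts us)
  then show ?case
    by (auto simp: remove_leaf_notin simp del: set_concat)
qed simp

text \<open>
  A forest with \<open>k\<close> vertices has \<open>2 * k + 1\<close> places for a new leaf: one in front, and for parts with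
  \<open>a + b = k - 1\<close> vertices another \<open>(2 * a + 1) + (2 * b + 1)\<close>. Different places give
  different forests because the label \<open>x\<close> is new.
\<close>

lemma card_leaf_insertions:
  "x \<notin> set (forest_labels f) \<Longrightarrow>
   finite (leaf_insertions x f) \<and> card (leaf_insertions x f) = 2 * length (forest_labels f) + 1"
proof (induction x f rule: leaf_insertions.induct)
  case (2 x v ts us)
  let ?A = "(\<lambda>ts'. Node v ts' # us) ` leaf_insertions x ts"
  let ?B = "(\<lambda>us'. Node v ts # us') ` leaf_insertions x us"
  have x: "x \<noteq> v" "x \<notin> set (forest_labels ts)" "x \<notin> set (forest_labels us)"
    using "2.prems" by auto
  have ts: "finite ?A" "card ?A = 2 * length (forest_labels ts) + 1"
    using "2.IH"(1) x by (auto simp: card_image inj_on_def)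
  have us: "finite ?B" "card ?B = 2 * length (forest_labels us) + 1"
    using "2.IH"(2) x by (auto simp: card_image inj_on_def)
  have "ts \<notin> leaf_insertions x ts"
    using x(2) leaf_insertion_set_labels by blast
  then have "?A \<inter> ?B = {}" by auto
  then have "card (?A \<union> ?B) = card ?A + card ?B"
    using ts us by (intro card_Un_disjoint)
  moreover have "Node x [] # Node v ts # us \<notin> ?A \<union> ?B"
    using x(1) by auto
  ultimately show ?case
    using ts us by (simp add: Un_assoc)
qed simp

text \<open>
  The largest label sits on a leaf, since children have larger labels than their parents; so removing it
  loses nothing but its place.
\<close>

lemma insert_removed_leaf:
  assumes "increasing_forest g" and "distinct (forest_labels g)" and "x \<in> set (forest_labels g)"
    and "\<forall>u\<in>set (forest_labels g). u \<le> x"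
  shows "g \<in> leaf_insertions x (remove_leaf x g) \<and> increasing_forest (remove_leaf x g)"
  using assms
proof (induction x g rule: remove_leaf.induct)
  case (2 x v ts us)
  have dts: "distinct (forest_labels ts)" and dus: "distinct (forest_labels us)"
    and disj: "set (forest_labels ts) \<inter> set (forest_labels us) = {}"
    using "2.prems"(2) by (auto simp: disjoint_iff)
  have inc: "\<forall>u\<in>set (forest_labels ts). v < u" "increasing_forest ts" "increasing_forest us"
    using "2.prems"(1) by auto
  have bound: "\<forall>u\<in>set (forest_labels ts). u \<le> x" "\<forall>u\<in>set (forest_labels us). u \<le> x"
    using "2.prems"(4) by auto
  consider "x = v" | "x \<noteq> v" "x \<in> set (forest_labels ts)" | "x \<noteq> v" "x \<in> set (forest_labels us)"
    using "2.prems"(3) by auto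
  then show ?case
  proof cases
    case 1
    have "set (forest_labels ts) = {}"
      using inc(1) bound(1) 1 by (meson equals0I leD)
    then have "ts = []"
      by (cases ts rule: increasing_forest.cases) auto
    then show ?thesis
      using 1 inc by (cases us rule: increasing_forest.cases) auto
  next
    case 2
    have IH: "ts \<in> leaf_insertions x (remove_leaf x ts)" "increasing_forest (remove_leaf x ts)"
      using "2.IH"(1) 2 inc dts bound by auto
    moreover have "remove_leaf x us = us"
      using 2 disj by (intro remove_leaf_notin) auto
    moreover have "set (forest_labels (remove_leaf x ts)) \<subseteq> set (forest_labels ts)"
      using leaf_insertion_set_labels[OF IH(1)] by blast
    ultimately show ?thesis
      using 2 inc by (auto simp del: set_concat)
  next
    case 3
    have "us \<in> leaf_insertions x (remove_leaf x us)" "increasing_forest (remove_leaf x us)"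
      using "2.IH"(2) 3 inc dus bound by auto
    moreover have "remove_leaf x ts = ts"
      using 3 disj by (intro remove_leaf_notin) auto
    ultimately show ?thesis
      using 3 inc by (auto simp del: set_concat)
  qed
qed simp

definition increasing_forests :: "nat set \<Rightarrow> nat plane_tree list set" where
  "increasing_forests V =
     {f. distinct (forest_labels f) \<and> set (forest_labels f) = V \<and> increasing_forest f}"

lemma increasing_forests_insert_max:
  assumes "\<forall>u\<in>V. u < x"
  shows "increasing_forests (insert x V) = (\<Union>f\<in>increasing_forests V. leaf_insertions x f)"
proof (intro equalityI subsetI)
  fix g assume g: "g \<in> increasing_forests (insert x V)"
  let ?f = "remove_leaf x g"
  have ins: "g \<in> leaf_insertions x ?f" and inc: "increasing_forest ?f"
    using insert_removed_leaf[of g x] g assms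
    by (auto simp: increasing_forests_def less_imp_le simp del: set_concat)
  have m: "mset (forest_labels g) = mset (x # forest_labels ?f)"
    using leaf_insertion_labels[OF ins] by simp
  then have "distinct (x # forest_labels ?f)"
    using g mset_eq_imp_distinct_iff unfolding increasing_forests_def by blast
  moreover have "insert x (set (forest_labels ?f)) = insert x V"
    using g leaf_insertion_set_labels[OF ins] by (simp add: increasing_forests_def)
  moreover have "x \<notin> V" using assms by auto
  ultimately have "?f \<in> increasing_forests V"
    using inc unfolding increasing_forests_def by (metis (mono_tags, lifting) distinct.simps(2) insert_ident mem_Collect_eq)
  then show "g \<in> (\<Union>f\<in>increasing_forests V. leaf_insertions x f)"
    using ins by blast
next
  fix g assume "g \<in> (\<Union>f\<in>increasing_forests V. leaf_insertions x f)"
  then obtain f where f: "f \<in> increasing_forests V" "g \<in> leaf_insertions x f" by blast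
  have "distinct (x # forest_labels f)"
    using f(1) assms by (auto simp: increasing_forests_def simp del: set_concat)
  then have "distinct (forest_labels g)"
    using leaf_insertion_labels[OF f(2)] mset_eq_imp_distinct_iff by (metis mset.simps(2))
  then show "g \<in> increasing_forests (insert x V)"
    using f leaf_insertion_set_labels[OF f(2)] leaf_insertion_increasing[OF f(2)] assms
    by (simp add: increasing_forests_def del: set_concat)
qed

lemma card_increasing_forests:
  "finite (increasing_forests {1..n}) \<and> card (increasing_forests {1..n}) = (\<Prod>i = 1..n. 2 * i - 1)"
proof (induction n)
  case 0
  have "f = []" if "forest_labels f = []" for f :: "nat plane_tree list"
    using that by (cases f rule: increasing_forest.cases) auto
  then have "increasing_forests {} = {[]}"
    by (auto simp: increasing_forests_def simp del: set_concat)
  then show ?case by simp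
next
  case (Suc n)
  let ?F = "increasing_forests {1..n}"
  have new: "Suc n \<notin> set (forest_labels f)" if "f \<in> ?F" for f
    using that by (simp add: increasing_forests_def del: set_concat)
  have len: "length (forest_labels f) = n" if "f \<in> ?F" for f
    using that distinct_card[of "forest_labels f"] by (simp add: increasing_forests_def del: set_concat)
  have "{1..Suc n} = insert (Suc n) {1..n}" by auto
  then have eq: "increasing_forests {1..Suc n} = (\<Union>f\<in>?F. leaf_insertions (Suc n) f)"
    by (simp add: increasing_forests_insert_max)
  have "card (\<Union>f\<in>?F. leaf_insertions (Suc n) f) = (\<Sum>f\<in>?F. card (leaf_insertions (Suc n) f))"
    using Suc new card_leaf_insertions remove_inserted_leaf
    by (intro card_UN_disjoint) (blast, blast, blast)
  also have "\<dots> = (\<Sum>f\<in>?F. 2 * n + 1)"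
    using card_leaf_insertions[OF new] len by (intro sum.cong) auto
  finally show ?case
    using Suc eq new card_leaf_insertions by (auto simp: mult.commute)
qed

text \<open>
  The root of an increasing tree carries the smallest label.
\<close>

lemma bij_betw_Node_0:
  "bij_betw (Node 0) (increasing_forests {1..n}) (increasing_trees n)"
proof -
  have iff: "Node 0 f \<in> increasing_trees n \<longleftrightarrow> f \<in> increasing_forests {1..n}" for f
  proof -
    have "{0..n} = insert 0 {1..n}" by auto
    then have "f \<in> increasing_forests {1..n} \<longleftrightarrow>
        distinct (0 # forest_labels f) \<and> set (0 # forest_labels f) = {0..n} \<and> increasing_forest [Node 0 f]"
      unfolding increasing_forests_def
      by (auto simp: Suc_le_eq insert_eq_iff simp del: set_concat)
    moreover have "length (0 # forest_labels f) = n + 1"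
      if "distinct (0 # forest_labels f)" "set (0 # forest_labels f) = {0..n}"
      using distinct_card[OF that(1)] that(2) by simp
    ultimately show ?thesis
      by (auto simp: increasing_trees_def increasing_iff_increasing_forest simp del: set_concat increasing.simps increasing_forest.simps)
  qed
  moreover have "\<exists>f. t = Node 0 f" if t: "t \<in> increasing_trees n" for t
  proof (cases t)
    case (Node v f)
    have "0 \<in> set (vertex_labels t)" "increasing_forest [t]"
      using t by (auto simp: increasing_trees_def increasing_iff_increasing_forest)
    then show ?thesis using Node by (auto simp del: set_concat)
  qed
  ultimately show ?thesis
    unfolding bij_betw_def inj_on_def by blast
qed

section \<open>Far-decreasing coefficients\<close>

text \<open>
  The index type of the coordinates is any finite linear order, whereas signed permutations act on
  \<open>{1..n}\<close>; this enumeration translates between the two. It also sorts the coordinates of a vector by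
  absolute value.
\<close>

lemma strict_mono_enumeration:
  fixes A :: "'a::linorder set"
  assumes "finite A"
  obtains h where "bij_betw h {1..card A} A" and "strict_mono_on {1..card A} h"
proof
  let ?xs = "sorted_list_of_set A"
  have len: "length ?xs = card A" by simp
  have "bij_betw (\<lambda>i. ?xs ! i) {..<card A} A"
    using assms len by (intro bij_betw_nth) auto
  moreover have "bij_betw (\<lambda>i. i - 1) {1..card A} {..<card A}"
    by (rule bij_betw_byWitness[where f' = Suc]) auto
  ultimately show "bij_betw (\<lambda>i. ?xs ! (i - 1)) {1..card A} A"
    using bij_betw_trans[of "\<lambda>i. i - 1" "{1..card A}" "{..<card A}"] unfolding comp_def by blast
  show "strict_mono_on {1..card A} (\<lambda>i. ?xs ! (i - 1))"
    using strict_sorted_list_of_set[of A] len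
    by (intro strict_mono_onI sorted_wrt_nth_less[of "(<)"]) auto
qed

lemma far_decreasing_gt:
  fixes l :: "real ^ 'n::{finite,linorder}"
  assumes "far_decreasing l"
  shows "l $ i > (\<Sum>j\<in>{i<..}. l $ j)"
proof (cases "i = Max UNIV")
  case True
  then have "{i<..} = {}" by (auto simp: not_less)
  then show ?thesis using assms True by (simp add: far_decreasing_def)
next
  case False
  then have "i < Max UNIV" by (simp add: order.strict_iff_order)
  then show ?thesis using assms by (simp add: far_decreasing_def)
qed

text \<open>
  At the largest index with a nonpositive coefficient, all later ones would be positive, and the
  coefficient exceeds their sum.
\<close>

lemma far_decreasing_pos:
  fixes l :: "real ^ 'n::{finite,linorder}"
  assumes "far_decreasing l"
  shows "l $ i > 0"
proof (rule ccontr)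
  assume i: "\<not> l $ i > 0"
  define N where "N = {i. \<not> l $ i > 0}"
  have "N \<noteq> {}" using i by (auto simp: N_def)
  then have "Max N \<in> N" by (intro Max_in) simp_all
  moreover have "l $ j > 0" if "j > Max N" for j
    using that Max_ge[of N j] unfolding N_def by (meson finite mem_Collect_eq not_less)
  then have "(\<Sum>j\<in>{Max N<..}. l $ j) \<ge> 0"
    by (intro sum_nonneg) (simp add: less_imp_le)
  then have "l $ Max N > 0" using far_decreasing_gt[OF assms, of "Max N"] by linarith
  ultimately show False by (simp add: N_def)
qed

text \<open>
  The term of the smallest index outweighs all the others together, whatever their signs.
\<close>

lemma far_decreasing_signed_sum:
  fixes l :: "real ^ 'n::{finite,linorder}"
  assumes l: "far_decreasing l" and ne: "A \<noteq> {}" and \<epsilon>: "\<And>j. j \<in> A \<Longrightarrow> \<epsilon> j \<in> {1, -1}"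
  shows "0 < \<epsilon> (Min A) * (\<Sum>j\<in>A. \<epsilon> j * l $ j)"
proof -
  let ?m = "Min A"
  have m: "?m \<in> A" using ne by (intro Min_in) simp_all
  have "\<bar>\<Sum>j\<in>A - {?m}. \<epsilon> j * l $ j\<bar> \<le> (\<Sum>j\<in>A - {?m}. \<bar>\<epsilon> j * l $ j\<bar>)"
    by (rule sum_abs)
  also have "\<dots> = (\<Sum>j\<in>A - {?m}. l $ j)"
    using \<epsilon> far_decreasing_pos[OF l] by (intro sum.cong) (force simp: abs_mult less_imp_le)+
  also have "\<dots> \<le> (\<Sum>j\<in>{?m<..}. l $ j)"
    using far_decreasing_pos[OF l] by (intro sum_mono2) (auto simp: less_imp_le order.strict_iff_order)
  also have "\<dots> < l $ ?m"
    by (rule far_decreasing_gt[OF l])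
  finally have "\<bar>\<Sum>j\<in>A - {?m}. \<epsilon> j * l $ j\<bar> < l $ ?m" .
  moreover have "(\<Sum>j\<in>A. \<epsilon> j * l $ j) = \<epsilon> ?m * l $ ?m + (\<Sum>j\<in>A - {?m}. \<epsilon> j * l $ j)"
    using m by (intro sum.remove) simp_all
  ultimately show ?thesis using \<epsilon>[OF m] by auto
qed

section \<open>Chambers cut by the affine hyperplane\<close>

text \<open>
  The entry \<open>p i\<close> is the index of the coordinate with the \<open>i\<close>-th largest absolute value, and
  \<open>\<epsilon> i\<close> is the sign of that coordinate.
\<close>

definition chamber :: "nat \<Rightarrow> (nat \<Rightarrow> 'n) \<Rightarrow> (nat \<Rightarrow> real) \<Rightarrow> (real ^ 'n::finite) set" where
  "chamber n p \<epsilon> = {x. (\<forall>i\<in>{1..n}. 0 < \<epsilon> i * x $ p i) \<and>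
     (\<forall>i\<in>{1..n}. \<forall>j\<in>{1..n}. i < j \<longrightarrow> \<epsilon> j * x $ p j < \<epsilon> i * x $ p i)}"

lemma open_chamber: "open (chamber n p \<epsilon>)"
proof -
  have eq: "chamber n p \<epsilon> = (\<Inter>i\<in>{1..n}. {x. 0 < \<epsilon> i * x $ p i}) \<inter>
      (\<Inter>i\<in>{1..n}. \<Inter>j\<in>{j\<in>{1..n}. i < j}. {x. \<epsilon> j * x $ p j < \<epsilon> i * x $ p i})"
    by (auto simp: chamber_def)
  show ?thesis
    unfolding eq
    by (intro open_Int open_INT ballI open_Collect_less continuous_intros) auto
qed

lemma convex_chamber: "convex (chamber n p \<epsilon>)"
proof (rule convexI)
  fix x y :: "real ^ 'a" and u v :: real
  assume xy: "x \<in> chamber n p \<epsilon>" "y \<in> chamber n p \<epsilon>" and uv: "0 \<le> u" "0 \<le> v" "u + v = 1"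
  have coord: "\<epsilon> i * (u *\<^sub>R x + v *\<^sub>R y) $ p i = u * (\<epsilon> i * x $ p i) + v * (\<epsilon> i * y $ p i)" for i
    by (simp add: algebra_simps)
  have lt: "u * a + v * b < u * c + v * d" if "a < c" "b < d" for a b c d :: real
  proof (cases "u = 0")
    case False
    then show ?thesis using that uv by (intro add_less_le_mono mult_strict_left_mono mult_left_mono) auto
  qed (use that uv in auto)
  have lt0: "0 < u * c + v * d" if "0 < c" "0 < d" for c d :: real
    using lt[of 0 c 0 d] that by simp
  show "u *\<^sub>R x + v *\<^sub>R y \<in> chamber n p \<epsilon>"
    using xy unfolding chamber_def mem_Collect_eq coord by (blast intro: lt lt0)
qed

lemma convex_slice: "convex (slice l)"
proof -
  have "slice l = {x. inner l x = 1}" by (simp add: slice_def inner_vec_def)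
  then show ?thesis by (simp add: convex_hyperplane)
qed

text \<open>
  Summation by parts rewrites \<open>\<Sum> y\<^sub>j s\<^sub>j\<close> as the sum of the \<open>(y\<^sub>j - y\<^sub>j\<^sub>+\<^sub>1) (s\<^sub>1 + \<dots> + s\<^sub>j)\<close> plus a boundary
  term. The factors \<open>y\<^sub>j - y\<^sub>j\<^sub>+\<^sub>1\<close> are nonnegative, so every partial sum of \<open>s\<close> may be replaced by its
  lower bound \<open>m\<close>.
\<close>

lemma summation_by_parts_lower_bound:
  fixes y s :: "nat \<Rightarrow> real"
  assumes "1 \<le> k" and "\<And>i. i \<in> {1..<k} \<Longrightarrow> y (Suc i) \<le> y i"
    and "\<And>i. i \<in> {1..k} \<Longrightarrow> m \<le> (\<Sum>j=1..i. s j)"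
  shows "m * (y 1 - y k) + y k * (\<Sum>j=1..k. s j) \<le> (\<Sum>j=1..k. y j * s j)"
  using assms
proof (induction k rule: dec_induct)
  case (step k)
  have "m * (y 1 - y k) + y k * (\<Sum>j=1..k. s j) \<le> (\<Sum>j=1..k. y j * s j)"
    using step.IH step.prems by auto
  moreover have "m * (y k - y (Suc k)) \<le> (\<Sum>j=1..k. s j) * (y k - y (Suc k))"
    using step.prems(1)[of k] step.prems(2)[of k] step.hyps by (intro mult_right_mono) auto
  ultimately show ?case
    using step.hyps by (simp add: algebra_simps)
qed simp

context
  fixes n :: nat and p :: "nat \<Rightarrow> 'n::finite" and \<epsilon> :: "nat \<Rightarrow> real" and l :: "real ^ 'n"
  assumes p: "bij_betw p {1..n} UNIV" and \<epsilon>: "\<And>i. i \<in> {1..n} \<Longrightarrow> \<epsilon> i \<in> {1, -1}"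
begin

lemma length_pos: "1 \<le> n"
  using p by (cases n) (auto simp: bij_betw_def)

lemma signed_coordinates:
  obtains x :: "real ^ 'n" where "\<And>i. i \<in> {1..n} \<Longrightarrow> \<epsilon> i * x $ p i = y i"
proof
  fix i assume i: "i \<in> {1..n}"
  then show "\<epsilon> i * (\<chi> j. \<epsilon> (inv_into {1..n} p j) * y (inv_into {1..n} p j)) $ p i = y i"
    using \<epsilon>[OF i] p by (auto simp: bij_betw_inv_into_left)
qed

lemma linear_form_chamber:
  "(\<Sum>j\<in>UNIV. l $ j * x $ j) = (\<Sum>i=1..n. (\<epsilon> i * x $ p i) * (\<epsilon> i * l $ p i))"
proof -
  have "(\<Sum>j\<in>UNIV. l $ j * x $ j) = (\<Sum>i=1..n. l $ p i * x $ p i)"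
    using p by (rule sum.reindex_bij_betw[symmetric])
  also have "\<dots> = (\<Sum>i=1..n. (\<epsilon> i * x $ p i) * (\<epsilon> i * l $ p i))"
    using \<epsilon> by (intro sum.cong) (force simp: algebra_simps)+
  finally show ?thesis .
qed

lemma chamber_decreasing:
  assumes "x \<in> chamber n p \<epsilon>" and "i \<in> {1..n}" and "j \<in> {1..n}" and "i \<le> j"
  shows "\<epsilon> j * x $ p j \<le> \<epsilon> i * x $ p i"
  using assms by (cases "i = j") (auto simp: chamber_def less_imp_le)

text \<open>
  The coordinate \<open>\<epsilon> 1 * x $ p 1\<close> is the maximum norm of \<open>x\<close>, so for \<open>m > 0\<close> this bounds the part
  of the chamber on which the linear form equals \<open>1\<close>.
\<close>

lemma linear_form_lower_bound:
  assumes x: "x \<in> chamber n p \<epsilon>" and m: "\<And>k. k \<in> {1..n} \<Longrightarrow> m \<le> (\<Sum>i=1..k. \<epsilon> i * l $ p i)"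
  shows "m * (\<epsilon> 1 * x $ p 1) \<le> (\<Sum>j\<in>UNIV. l $ j * x $ j)"
proof -
  let ?y = "\<lambda>i. \<epsilon> i * x $ p i"
  have "m * (?y 1 - ?y n) + ?y n * (\<Sum>i=1..n. \<epsilon> i * l $ p i) \<le> (\<Sum>j\<in>UNIV. l $ j * x $ j)"
    unfolding linear_form_chamber
    using length_pos m chamber_decreasing[OF x] by (intro summation_by_parts_lower_bound) auto
  moreover have "?y n * m \<le> ?y n * (\<Sum>i=1..n. \<epsilon> i * l $ p i)"
    using x length_pos m[of n] by (intro mult_left_mono) (auto simp: chamber_def less_imp_le)
  ultimately show ?thesis by (simp add: algebra_simps)
qed

text \<open>
  Boundedness comes from \<open>linear_form_lower_bound\<close>. By the same bound the form is positive at
  every point of the cone, and rescaling such a point moves it into the slice.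
\<close>

lemma bounded_chamber_slice:
  assumes pos: "\<And>k. k \<in> {1..n} \<Longrightarrow> 0 < (\<Sum>i=1..k. \<epsilon> i * l $ p i)"
  shows "bounded (chamber n p \<epsilon> \<inter> slice l)" and "chamber n p \<epsilon> \<inter> slice l \<noteq> {}"
proof -
  define m where "m = Min ((\<lambda>k. \<Sum>i=1..k. \<epsilon> i * l $ p i) ` {1..n})"
  have m: "0 < m"
    unfolding m_def using length_pos pos by (subst Min_gr_iff) auto
  have m_le: "m \<le> (\<Sum>i=1..k. \<epsilon> i * l $ p i)" if "k \<in> {1..n}" for k
    unfolding m_def using that by (intro Min_le) auto
  have coord: "\<bar>x $ j\<bar> \<le> 1 / m" if x: "x \<in> chamber n p \<epsilon>" "x \<in> slice l" for x j
  proof -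
    obtain i where i: "i \<in> {1..n}" "j = p i"
      using p by (metis UNIV_I bij_betw_imp_surj_on imageE)
    have "0 < \<epsilon> i * x $ p i"
      using x(1) i by (simp add: chamber_def)
    then have "\<bar>x $ j\<bar> = \<epsilon> i * x $ p i"
      using i(2) \<epsilon>[OF i(1)] by auto
    also have "\<dots> \<le> \<epsilon> 1 * x $ p 1"
      using i by (intro chamber_decreasing[OF x(1)]) auto
    also have "\<dots> \<le> 1 / m"
      using linear_form_lower_bound[OF x(1) m_le] x(2) m by (simp add: slice_def field_simps)
    finally show ?thesis .
  qed
  show "bounded (chamber n p \<epsilon> \<inter> slice l)"
  proof (rule boundedI)
    fix x assume "x \<in> chamber n p \<epsilon> \<inter> slice l"
    then show "norm x \<le> (\<Sum>j\<in>(UNIV :: 'n set). 1 / m)"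
      using coord by (intro order.trans[OF norm_le_l1_cart] sum_mono) auto
  qed
  obtain x :: "real ^ 'n" where x: "\<And>i. i \<in> {1..n} \<Longrightarrow> \<epsilon> i * x $ p i = real (Suc n - i)"
    using signed_coordinates[where y = "\<lambda>i. real (Suc n - i)"] by blast
  have xc: "x \<in> chamber n p \<epsilon>"
    using x by (auto simp: chamber_def)
  define c where "c = (\<Sum>j\<in>UNIV. l $ j * x $ j)"
  have "0 < m * (\<epsilon> 1 * x $ p 1)"
    using m xc length_pos by (auto simp: chamber_def)
  then have c: "0 < c"
    using linear_form_lower_bound[OF xc m_le] by (simp add: c_def)
  have "(1 / c) *\<^sub>R x \<in> chamber n p \<epsilon>"
    using xc c by (auto simp: chamber_def divide_simps mult.commute)
  moreover have "(1 / c) *\<^sub>R x \<in> slice l"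
    using c by (simp add: slice_def flip: c_def sum_divide_distrib)
  ultimately show "chamber n p \<epsilon> \<inter> slice l \<noteq> {}" by blast
qed

text \<open>
  Let \<open>r\<close> be the \<open>k\<close>-th extreme ray, on which the form has the value \<open>S < 0\<close>. For a point \<open>x\<close> of the
  chamber in the slice the form vanishes at \<open>x - r / S\<close>, which again lies in the open cone, so the
  half-line from \<open>x\<close> in this direction stays in both.
\<close>

lemma unbounded_chamber_slice:
  assumes k: "k \<in> {1..n}" and neg: "(\<Sum>i=1..k. \<epsilon> i * l $ p i) < 0"
    and ne: "chamber n p \<epsilon> \<inter> slice l \<noteq> {}"
  shows "\<not> bounded (chamber n p \<epsilon> \<inter> slice l)"
proof
  assume "bounded (chamber n p \<epsilon> \<inter> slice l)"
  then obtain B where B: "\<And>x. x \<in> chamber n p \<epsilon> \<inter> slice l \<Longrightarrow> norm x \<le> B"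
    by (auto simp: bounded_iff)
  obtain x where x: "x \<in> chamber n p \<epsilon>" "x \<in> slice l" using ne by blast
  define S where "S = (\<Sum>i=1..k. \<epsilon> i * l $ p i)"
  define s where "s = - 1 / S"
  have s: "0 < s" using neg by (simp add: s_def S_def)
  obtain r :: "real ^ 'n" where r: "\<And>i. i \<in> {1..n} \<Longrightarrow> \<epsilon> i * r $ p i = (if i \<le> k then 1 else 0)"
    using signed_coordinates[where y = "\<lambda>i. if i \<le> k then 1 else 0"] by blast
  have lr: "(\<Sum>j\<in>UNIV. l $ j * r $ j) = S"
  proof -
    have "(\<Sum>j\<in>UNIV. l $ j * r $ j) = (\<Sum>i=1..n. if i \<le> k then \<epsilon> i * l $ p i else 0)"
      unfolding linear_form_chamber using r by (intro sum.cong) auto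
    also have "\<dots> = (\<Sum>i\<in>{i\<in>{1..n}. i \<le> k}. \<epsilon> i * l $ p i)"
      by (rule sum.inter_filter[symmetric]) simp
    also have "{i\<in>{1..n}. i \<le> k} = {1..k}" using k by auto
    finally show ?thesis by (simp add: S_def)
  qed
  define y1 where "y1 = \<epsilon> 1 * x $ p 1"
  have y1: "0 < y1" using x(1) length_pos by (auto simp: chamber_def y1_def)
  have "norm x \<le> B" using B x by blast
  then have "0 \<le> B" using norm_ge_zero[of x] by linarith
text \<open>
  Chosen such that the largest coordinate of \<open>x + t *\<^sub>R (x + s *\<^sub>R r)\<close> exceeds \<open>B\<close>.
\<close>

  define t where "t = (B + 1) / y1"
  have t: "0 < t" using y1 \<open>0 \<le> B\<close> by (simp add: t_def)
  define z where "z = x + t *\<^sub>R (x + s *\<^sub>R r)"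
  have z: "\<epsilon> i * z $ p i = (1 + t) * (\<epsilon> i * x $ p i) + t * s * (if i \<le> k then 1 else 0)"
    if "i \<in> {1..n}" for i
  proof -
    have "\<epsilon> i * z $ p i = (1 + t) * (\<epsilon> i * x $ p i) + t * s * (\<epsilon> i * r $ p i)"
      by (simp add: z_def algebra_simps)
    then show ?thesis using r[OF that] by simp
  qed
  have "z \<in> chamber n p \<epsilon>"
  proof -
    have "0 < \<epsilon> i * z $ p i" if i: "i \<in> {1..n}" for i
    proof -
      have "0 < (1 + t) * (\<epsilon> i * x $ p i)"
        using x(1) i t by (intro mult_pos_pos[of "1 + t"]) (auto simp: chamber_def)
      moreover have "0 \<le> t * s * (if i \<le> k then 1 else 0)"
        using s t by simp
      ultimately show ?thesis unfolding z[OF i] by linarith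
    qed
    moreover have "\<epsilon> j * z $ p j < \<epsilon> i * z $ p i"
      if "i \<in> {1..n}" "j \<in> {1..n}" "i < j" for i j
      unfolding z[OF that(1)] z[OF that(2)] using x(1) that s t
      by (intro add_less_le_mono mult_strict_left_mono) (auto simp: chamber_def)
    ultimately show ?thesis by (simp add: chamber_def)
  qed
  moreover have "z \<in> slice l"
  proof -
    have "(\<Sum>j\<in>UNIV. l $ j * z $ j) =
        (1 + t) * (\<Sum>j\<in>UNIV. l $ j * x $ j) + t * s * (\<Sum>j\<in>UNIV. l $ j * r $ j)"
      unfolding z_def sum_distrib_left sum.distrib[symmetric]
      by (intro sum.cong) (auto simp: algebra_simps)
    also have "\<dots> = 1"
      using x(2) neg by (simp add: slice_def lr s_def S_def)
    finally show ?thesis by (simp add: slice_def)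
  qed
  ultimately have "norm z \<le> B" using B by blast
  moreover have "\<bar>z $ p 1\<bar> \<le> norm z" by (rule component_le_norm_cart)
  moreover have "t * y1 \<le> \<bar>z $ p 1\<bar>"
  proof -
    have "\<epsilon> 1 * z $ p 1 = (1 + t) * y1 + t * s"
      using z[of 1] k by (simp add: y1_def)
    moreover have "0 \<le> t * s" using s t by simp
    ultimately have "t * y1 \<le> \<epsilon> 1 * z $ p 1"
      using y1 by (simp add: distrib_right)
    also have "\<dots> \<le> \<bar>z $ p 1\<bar>"
      using \<epsilon>[of 1] length_pos by auto
    finally show ?thesis .
  qed
  moreover have "t * y1 = B + 1" using y1 by (simp add: t_def)
  ultimately show False by linarith
qed

end

section \<open>Regions of the restricted arrangement\<close>

text \<open>
  A connected subset of a union of disjoint open sets lies in one of them, so the connected traces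
  \<open>U \<inter> P\<close> cannot be enlarged.
\<close>

lemma components_Int_disjoint_open_Union:
  assumes op: "\<And>U. U \<in> \<U> \<Longrightarrow> open U" and dis: "disjoint \<U>"
    and con: "\<And>U. U \<in> \<U> \<Longrightarrow> connected (U \<inter> P)"
  shows "components (P \<inter> \<Union>\<U>) = {U \<inter> P | U. U \<in> \<U> \<and> U \<inter> P \<noteq> {}}"
proof -
  have comp: "U \<inter> P \<in> components (P \<inter> \<Union>\<U>)" if U: "U \<in> \<U>" and ne: "U \<inter> P \<noteq> {}" for U
    unfolding in_components_maximal
  proof (intro conjI allI impI)
    fix D assume D: "D \<noteq> {} \<and> U \<inter> P \<subseteq> D \<and> D \<subseteq> P \<inter> \<Union>\<U> \<and> connected D"
    have "open (\<Union>(\<U> - {U}))" using op by blast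
    moreover have "U \<inter> \<Union>(\<U> - {U}) = {}"
      using dis U by (auto simp: disjoint_def)
    moreover have "D \<subseteq> U \<union> \<Union>(\<U> - {U})" using D by blast
    ultimately have "U \<inter> D = {} \<or> \<Union>(\<U> - {U}) \<inter> D = {}"
      using D op[OF U] by (intro connectedD) auto
    moreover have "U \<inter> D \<noteq> {}" using D ne by blast
    ultimately show "D = U \<inter> P" using D by blast
  qed (use con U ne in auto)
  moreover have "\<exists>U. C = U \<inter> P \<and> U \<in> \<U> \<and> U \<inter> P \<noteq> {}" if C: "C \<in> components (P \<inter> \<Union>\<U>)" for C
  proof -
    obtain x where x: "x \<in> C" using C in_components_nonempty by blast
    then obtain U where U: "U \<in> \<U>" "x \<in> U" "x \<in> P"
      using in_components_subset[OF C] by blast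
    then have "C = U \<inter> P"
      using components_eq[OF C comp[of U]] x by blast
    then show ?thesis using U by blast
  qed
  ultimately show ?thesis by blast
qed

text \<open>
  The position of an element is determined by the number of elements with a larger value of \<open>f\<close>.
\<close>

lemma decreasing_listing_unique:
  fixes f :: "'b \<Rightarrow> 'c::linorder" and a b :: "nat \<Rightarrow> 'b"
  assumes a: "bij_betw a {1..n} V" and b: "bij_betw b {1..n} V"
    and fa: "\<And>i j. i \<in> {1..n} \<Longrightarrow> j \<in> {1..n} \<Longrightarrow> i < j \<Longrightarrow> f (a j) < f (a i)"
    and fb: "\<And>i j. i \<in> {1..n} \<Longrightarrow> j \<in> {1..n} \<Longrightarrow> i < j \<Longrightarrow> f (b j) < f (b i)"
    and i: "i \<in> {1..n}"
  shows "a i = b i"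
proof -
  have rank: "card {v\<in>V. f (c i) < f v} = i - 1"
    if c: "bij_betw c {1..n} V" and i: "i \<in> {1..n}"
      and fc: "\<And>i j. i \<in> {1..n} \<Longrightarrow> j \<in> {1..n} \<Longrightarrow> i < j \<Longrightarrow> f (c j) < f (c i)" for c :: "nat \<Rightarrow> 'b" and i
  proof -
    have "f (c i) < f (c j) \<longleftrightarrow> j < i" if "j \<in> {1..n}" for j
      using fc[OF i that] fc[OF that i] by (cases i j rule: linorder_cases) auto
    then have "{v\<in>V. f (c i) < f v} = c ` {1..<i}"
      using c i by (auto simp: bij_betw_def image_iff)
    moreover have "inj_on c {1..<i}"
      using c i by (auto simp: bij_betw_def intro: inj_on_subset)
    ultimately show ?thesis by (simp add: card_image)
  qed
  obtain j where j: "j \<in> {1..n}" "a i = b j"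
    using a b i by (metis bij_betw_apply bij_betw_imp_surj_on imageE)
  have "i - 1 = j - 1"
    using rank[OF a i fa] rank[OF b j(1) fb] j(2) by simp
  then have "i = j" using i j(1) by auto
  then show ?thesis using j(2) by simp
qed

context
  fixes n :: nat and e :: "nat \<Rightarrow> 'n::{finite,linorder}"
  assumes e: "bij_betw e {1..n} UNIV" and e_mono: "strict_mono_on {1..n} e"
begin

definition signed_chamber :: "(nat \<Rightarrow> nat) \<times> (nat \<Rightarrow> int) \<Rightarrow> (real ^ 'n::{finite,linorder}) set" where
  "signed_chamber = (\<lambda>(a, \<sigma>). chamber n (e \<circ> a) (\<lambda>i. of_int (\<sigma> (a i))))"

lemma signed_permutationD:
  assumes "(a, \<sigma>) \<in> signed_permutations n"
  shows "bij_betw a {1..n} {1..n}" and "bij_betw (e \<circ> a) {1..n} UNIV"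
    and "i \<in> {1..n} \<Longrightarrow> real_of_int (\<sigma> i) \<in> {1, -1}"
    and "i \<in> {1..n} \<Longrightarrow> a i \<in> {1..n}"
    and "i \<in> {1..n} \<Longrightarrow> real_of_int (\<sigma> (a i)) \<in> {1, -1}"
proof -
  show a: "bij_betw a {1..n} {1..n}"
    using assms by (simp add: signed_permutations_def permutes_imp_bij)
  then show "bij_betw (e \<circ> a) {1..n} UNIV" using e by (rule bij_betw_trans)
  have \<sigma>: "real_of_int (\<sigma> i) \<in> {1, -1}" if "i \<in> {1..n}" for i
    using assms that by (force simp: signed_permutations_def)
  then show "i \<in> {1..n} \<Longrightarrow> real_of_int (\<sigma> i) \<in> {1, -1}" .
  show ai: "i \<in> {1..n} \<Longrightarrow> a i \<in> {1..n}" using a by (rule bij_betw_apply)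
  show "i \<in> {1..n} \<Longrightarrow> real_of_int (\<sigma> (a i)) \<in> {1, -1}" using \<sigma> ai by blast
qed

lemma signed_chamber_abs:
  assumes w: "(a, \<sigma>) \<in> signed_permutations n" and x: "x \<in> signed_chamber (a, \<sigma>)"
    and i: "i \<in> {1..n}"
  shows "of_int (\<sigma> (a i)) * x $ e (a i) = \<bar>x $ e (a i)\<bar>" and "x $ e (a i) \<noteq> 0"
    and "of_int (\<sigma> (a i)) = sgn (x $ e (a i))"
proof -
  have pos: "0 < of_int (\<sigma> (a i)) * x $ e (a i)"
    using x i by (simp add: signed_chamber_def chamber_def)
  then show "of_int (\<sigma> (a i)) * x $ e (a i) = \<bar>x $ e (a i)\<bar>" "x $ e (a i) \<noteq> 0"
      "of_int (\<sigma> (a i)) = sgn (x $ e (a i))"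
    using signed_permutationD(5)[OF w i] by (auto simp: sgn_if)
qed

lemma signed_chamber_abs_less:
  assumes w: "(a, \<sigma>) \<in> signed_permutations n" and x: "x \<in> signed_chamber (a, \<sigma>)"
    and ij: "i \<in> {1..n}" "j \<in> {1..n}" "i < j"
  shows "\<bar>x $ e (a j)\<bar> < \<bar>x $ e (a i)\<bar>"
proof -
  have "of_int (\<sigma> (a j)) * x $ e (a j) < of_int (\<sigma> (a i)) * x $ e (a i)"
    using x ij by (simp add: signed_chamber_def chamber_def)
  then show ?thesis using signed_chamber_abs(1)[OF w x] ij by simp
qed

text \<open>
  The signs of the coordinates and the order of their absolute values can be read off from \<open>x\<close>.
\<close>

lemma signed_chamber_unique:
  assumes w: "w \<in> signed_permutations n" "w' \<in> signed_permutations n"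
    and x: "x \<in> signed_chamber w" "x \<in> signed_chamber w'"
  shows "w = w'"
proof -
  obtain a \<sigma> a' \<sigma>' where ww: "w = (a, \<sigma>)" "w' = (a', \<sigma>')" by (cases w, cases w')
  note w = w[unfolded ww] and x = x[unfolded ww]
  have aa: "a i = a' i" if "i \<in> {1..n}" for i
    using signed_permutationD(1)[OF w(1)] signed_permutationD(1)[OF w(2)]
      signed_chamber_abs_less[OF w(1) x(1)] signed_chamber_abs_less[OF w(2) x(2)] that
    by (rule decreasing_listing_unique[where f = "\<lambda>v. \<bar>x $ e v\<bar>"])
  then have "a = a'"
    using w unfolding signed_permutations_def fun_eq_iff
    by (metis (no_types, lifting) SigmaD1 mem_Collect_eq permutes_not_in)
  moreover have "\<sigma> v = \<sigma>' v" if v: "v \<in> {1..n}" for v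
  proof -
    obtain i where i: "i \<in> {1..n}" "v = a i"
      using signed_permutationD(1)[OF w(1)] v by (metis bij_betw_imp_surj_on imageE)
    have "real_of_int (\<sigma> v) = real_of_int (\<sigma>' v)"
      using signed_chamber_abs(3)[OF w(1) x(1) i(1)] signed_chamber_abs(3)[OF w(2) x(2) i(1)]
        aa[OF i(1)] i(2) by simp
    then show ?thesis by simp
  qed
  then have "\<sigma> = \<sigma>'"
    using w by (intro PiE_ext[of _ "{1..n}" "\<lambda>_. {1, -1}"]) (auto simp: signed_permutations_def)
  ultimately show ?thesis by (simp add: ww)
qed

text \<open>
  Sort the indices by decreasing absolute value of the coordinate.
\<close>

lemma signed_chamber_exists:
  fixes x :: "real ^ 'n::{finite,linorder}"
  assumes nz: "\<And>i. x $ i \<noteq> 0" and neq: "\<And>i j. i \<noteq> j \<Longrightarrow> \<bar>x $ i\<bar> \<noteq> \<bar>x $ j\<bar>"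
  obtains w where "w \<in> signed_permutations n" "x \<in> signed_chamber w"
proof -
  define f where "f = (\<lambda>i. - \<bar>x $ e i\<bar>)"
  have inj: "inj_on f {1..n}"
  proof (rule inj_onI)
    fix i j assume ij: "i \<in> {1..n}" "j \<in> {1..n}" and "f i = f j"
    then have "e i = e j" using neq[of "e i" "e j"] by (auto simp: f_def)
    then show "i = j" using e ij by (auto simp: bij_betw_def dest: inj_onD)
  qed
  then have f: "bij_betw f {1..n} (f ` {1..n})" and cd: "card (f ` {1..n}) = n"
    by (auto simp: inj_on_imp_bij_betw card_image)
  obtain h where h: "bij_betw h {1..n} (f ` {1..n})" and h_mono: "strict_mono_on {1..n} h"
    using strict_mono_enumeration[of "f ` {1..n}"] cd by auto
  define a where "a = (\<lambda>i. if i \<in> {1..n} then inv_into {1..n} f (h i) else i)"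
  define \<sigma> where "\<sigma> = (\<lambda>i\<in>{1..n}. if 0 < x $ e i then 1 else -1 :: int)"
  have "bij_betw (inv_into {1..n} f \<circ> h) {1..n} {1..n}"
    using h bij_betw_inv_into[OF f] by (rule bij_betw_trans)
  then have "bij_betw a {1..n} {1..n}"
    by (rule bij_betw_cong[THEN iffD1, rotated]) (simp add: a_def)
  then have a: "a permutes {1..n}" and ain: "\<And>i. i \<in> {1..n} \<Longrightarrow> a i \<in> {1..n}"
    by (auto simp: a_def intro!: bij_imp_permutes dest: bij_betw_apply)
  have fa: "f (a i) = h i" if "i \<in> {1..n}" for i
    using that h by (simp add: a_def f_inv_into_f bij_betw_apply)
  have pos: "of_int (\<sigma> (a i)) * x $ e (a i) = \<bar>x $ e (a i)\<bar>" if "i \<in> {1..n}" for i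
    using ain[OF that] by (simp add: \<sigma>_def)
  have "(a, \<sigma>) \<in> signed_permutations n"
    using a by (auto simp: signed_permutations_def \<sigma>_def)
  moreover have "x \<in> signed_chamber (a, \<sigma>)"
  proof -
    have "\<bar>x $ e (a j)\<bar> < \<bar>x $ e (a i)\<bar>" if "i \<in> {1..n}" "j \<in> {1..n}" "i < j" for i j
      using strict_mono_onD[OF h_mono that] fa[OF that(1)] fa[OF that(2)] by (simp add: f_def)
    then show ?thesis
      using nz by (simp add: signed_chamber_def chamber_def pos)
  qed
  ultimately show ?thesis using that by blast
qed

text \<open>
  Off the hyperplanes the absolute values of the coordinates are nonzero and pairwise distinct, because
  \<open>\<bar>x $ i\<bar> = \<bar>x $ j\<bar>\<close> means that \<open>x $ i + x $ j\<close> or \<open>x $ i - x $ j\<close> vanishes.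
\<close>

lemma slice_minus_arrangement:
  "P - \<Union>(restricted_arrangement type_B_arrangement P) =
   P \<inter> \<Union>(signed_chamber ` signed_permutations n)"
proof (intro equalityI subsetI)
  fix x assume x: "x \<in> P - \<Union>(restricted_arrangement type_B_arrangement P)"
  then have off: "x \<notin> H" if "H \<in> type_B_arrangement" for H
    using that by (auto simp: restricted_arrangement_def)
  have nz: "x $ i \<noteq> 0" for i
  proof -
    have "{x. x $ i = 0} \<in> type_B_arrangement" by (auto simp: type_B_arrangement_def)
    then show ?thesis using off by blast
  qed
  have lt: "\<bar>x $ i\<bar> \<noteq> \<bar>x $ j\<bar>" if "i < j" for i j
  proof -
    have "{x. x $ i + x $ j = 0} \<in> type_B_arrangement" "{x. x $ i - x $ j = 0} \<in> type_B_arrangement"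
      using that by (auto simp: type_B_arrangement_def)
    then have "x $ i + x $ j \<noteq> 0" "x $ i - x $ j \<noteq> 0" using off by blast+
    then show ?thesis by (auto simp: abs_eq_iff)
  qed
  have neq: "\<bar>x $ i\<bar> \<noteq> \<bar>x $ j\<bar>" if "i \<noteq> j" for i j
    using that lt[of i j] lt[of j i] by (metis linorder_neqE)
  obtain w where "w \<in> signed_permutations n" "x \<in> signed_chamber w"
    using nz neq by (rule signed_chamber_exists)
  then show "x \<in> P \<inter> \<Union>(signed_chamber ` signed_permutations n)" using x by blast
next
  fix x assume "x \<in> P \<inter> \<Union>(signed_chamber ` signed_permutations n)"
  then obtain a \<sigma> where P: "x \<in> P" and w: "(a, \<sigma>) \<in> signed_permutations n"
    and x: "x \<in> signed_chamber (a, \<sigma>)"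
    by auto
  have pre: "\<exists>i\<in>{1..n}. j = e (a i)" for j
    using signed_permutationD(2)[OF w] by (force simp: bij_betw_def)
  have nz: "x $ j \<noteq> 0" for j
    using pre[of j] signed_chamber_abs(2)[OF w x] by auto
  have neq: "\<bar>x $ j\<bar> \<noteq> \<bar>x $ k\<bar>" if "j \<noteq> k" for j k
  proof -
    obtain i i' where i: "i \<in> {1..n}" "j = e (a i)" and i': "i' \<in> {1..n}" "k = e (a i')"
      using pre by meson
    then show ?thesis
      using signed_chamber_abs_less[OF w x i(1) i'(1)] signed_chamber_abs_less[OF w x i'(1) i(1)] that
      by (cases i i' rule: linorder_cases) auto
  qed
  have "x \<notin> H" if H: "H \<in> type_B_arrangement" for H
  proof -
    consider (coordinate) i where "H = {x. x $ i = 0}"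
      | (sum) i j where "i < j" "H = {x. x $ i + x $ j = 0}"
      | (difference) i j where "i < j" "H = {x. x $ i - x $ j = 0}"
      using H unfolding type_B_arrangement_def by blast
    then show ?thesis
    proof cases
      case coordinate
      then show ?thesis using nz by simp
    next
      case sum
      have "\<bar>x $ i\<bar> \<noteq> \<bar>x $ j\<bar>" using neq[of i j] sum(1) by simp
      then have "x $ i + x $ j \<noteq> 0" by linarith
      then show ?thesis using sum(2) by simp
    next
      case difference
      have "\<bar>x $ i\<bar> \<noteq> \<bar>x $ j\<bar>" using neq[of i j] difference(1) by simp
      then show ?thesis using difference(2) by auto
    qed
  qed
  then show "x \<in> P - \<Union>(restricted_arrangement type_B_arrangement P)"
    using P by (auto simp: restricted_arrangement_def)
qed

lemma regions_slice:
  "regions (slice l) (restricted_arrangement type_B_arrangement (slice l)) =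
   {signed_chamber w \<inter> slice l | w. w \<in> signed_permutations n \<and> signed_chamber w \<inter> slice l \<noteq> {}}"
proof -
  let ?U = "signed_chamber ` signed_permutations n"
  have "open U \<and> connected (U \<inter> slice l)" if "U \<in> ?U" for U
    using that by (auto simp: signed_chamber_def
        intro!: open_chamber convex_connected convex_Int convex_chamber convex_slice)
  moreover have "disjoint ?U"
    unfolding disjoint_def using signed_chamber_unique by blast
  ultimately have "components (slice l \<inter> \<Union>?U) = {U \<inter> slice l | U. U \<in> ?U \<and> U \<inter> slice l \<noteq> {}}"
    by (intro components_Int_disjoint_open_Union) auto
  then show ?thesis
    unfolding regions_def slice_minus_arrangement by blast
qed

text \<open>
  This is \<open>far_decreasing_signed_sum\<close> for the set of the first \<open>k\<close> entries, transported along the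
  monotone enumeration \<open>e\<close>, which preserves minima.
\<close>

lemma prefix_sum_sign:
  assumes l: "far_decreasing l" and w: "(a, \<sigma>) \<in> signed_permutations n" and k: "k \<in> {1..n}"
  shows "0 < of_int (\<sigma> (left_to_right_min a k)) * (\<Sum>i=1..k. of_int (\<sigma> (a i)) * l $ (e \<circ> a) i)"
proof -
  let ?A = "a ` {1..k}"
  let ?\<epsilon> = "\<lambda>j. real_of_int (\<sigma> (inv_into {1..n} e j))"
  have A: "?A \<subseteq> {1..n}" "?A \<noteq> {}"
  proof -
    show "?A \<subseteq> {1..n}"
    proof (rule image_subsetI)
      fix i assume "i \<in> {1..k}"
      then have "i \<in> {1..n}" using k by simp
      then show "a i \<in> {1..n}" by (rule signed_permutationD(4)[OF w])
    qed
    show "?A \<noteq> {}" using k by simp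
  qed
  have inv: "inv_into {1..n} e (e v) = v" if "v \<in> {1..n}" for v
    using bij_betw_inv_into_left[OF e that] .
  have e_min: "Min (e ` ?A) = e (Min ?A)"
  proof (rule Min_eqI)
    have m: "Min ?A \<in> ?A" using A by (intro Min_in) auto
    then show "e (Min ?A) \<in> e ` ?A" by (rule imageI)
    fix y assume "y \<in> e ` ?A"
    then obtain v where v: "v \<in> ?A" "y = e v" by auto
    then have "Min ?A \<le> v" by (intro Min_le) auto
    moreover have "mono_on {1..n} e" using e_mono by (rule strict_mono_on_imp_mono_on)
    moreover have "Min ?A \<in> {1..n}" "v \<in> {1..n}" using v(1) m A(1) by blast+
    ultimately show "e (Min ?A) \<le> y" unfolding v(2) by (metis mono_onD)
  qed simp
  have "0 < ?\<epsilon> (Min (e ` ?A)) * (\<Sum>j\<in>e ` ?A. ?\<epsilon> j * l $ j)"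
  proof (rule far_decreasing_signed_sum[OF l])
    fix j assume "j \<in> e ` ?A"
    then show "?\<epsilon> j \<in> {1, -1}"
      using A signed_permutationD(3)[OF w] inv by (metis imageE subsetD)
  qed (use A in simp)
  also have "?\<epsilon> (Min (e ` ?A)) = of_int (\<sigma> (left_to_right_min a k))"
    using Min_in[of ?A] A inv unfolding e_min left_to_right_min_def by (metis finite_imageI finite_atLeastAtMost subsetD)
  also have "(\<Sum>j\<in>e ` ?A. ?\<epsilon> j * l $ j) = (\<Sum>i=1..k. ?\<epsilon> ((e \<circ> a) i) * l $ (e \<circ> a) i)"
  proof -
    have "inj_on (e \<circ> a) {1..k}"
      using signed_permutationD(2)[OF w] k by (auto simp: bij_betw_def intro: inj_on_subset)
    then show ?thesis
      by (simp only: image_comp sum.reindex comp_def)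
  qed
  also have "\<dots> = (\<Sum>i=1..k. of_int (\<sigma> (a i)) * l $ (e \<circ> a) i)"
  proof (intro sum.cong refl)
    fix i assume "i \<in> {1..k}"
    then have "a i \<in> {1..n}" using A(1) by blast
    then show "?\<epsilon> ((e \<circ> a) i) * l $ (e \<circ> a) i = of_int (\<sigma> (a i)) * l $ (e \<circ> a) i"
      using inv[of "a i"] by simp
  qed
  finally show ?thesis .
qed

lemma bounded_region_iff:
  assumes l: "far_decreasing l" and w: "w \<in> signed_permutations n"
  shows "signed_chamber w \<inter> slice l \<noteq> {} \<and> bounded (signed_chamber w \<inter> slice l) \<longleftrightarrow>
    w \<in> positive_minima_signed_permutations n"
proof -
  obtain a \<sigma> where w_eq: "w = (a, \<sigma>)" by (cases w)
  note w = w[unfolded w_eq]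
  note p = signed_permutationD(2)[OF w] and \<epsilon> = signed_permutationD(5)[OF w]
  show ?thesis
  proof
    assume pos: "w \<in> positive_minima_signed_permutations n"
    have "0 < (\<Sum>i=1..k. of_int (\<sigma> (a i)) * l $ (e \<circ> a) i)" if "k \<in> {1..n}" for k
      using prefix_sum_sign[OF l w that] pos that
      by (simp add: w_eq positive_minima_signed_permutations_def)
    then show "signed_chamber w \<inter> slice l \<noteq> {} \<and> bounded (signed_chamber w \<inter> slice l)"
      using bounded_chamber_slice[where l = l and \<epsilon> = "\<lambda>i. of_int (\<sigma> (a i))", OF p \<epsilon>]
      by (simp add: w_eq signed_chamber_def)
  next
    assume *: "signed_chamber w \<inter> slice l \<noteq> {} \<and> bounded (signed_chamber w \<inter> slice l)"
    have "\<sigma> (left_to_right_min a k) = 1" if k: "k \<in> {1..n}" for k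
    proof (rule ccontr)
      assume "\<sigma> (left_to_right_min a k) \<noteq> 1"
      moreover have "left_to_right_min a k \<in> {1..n}"
      proof -
        have "left_to_right_min a k \<in> a ` {1..k}"
          unfolding left_to_right_min_def using k by (intro Min_in) auto
        then show ?thesis using signed_permutationD(4)[OF w] k by force
      qed
      ultimately have "\<sigma> (left_to_right_min a k) = -1"
        using signed_permutationD(3)[OF w] by fastforce
      then have "(\<Sum>i=1..k. of_int (\<sigma> (a i)) * l $ (e \<circ> a) i) < 0"
        using prefix_sum_sign[OF l w k] by simp
      then show False
        using unbounded_chamber_slice[where l = l and \<epsilon> = "\<lambda>i. of_int (\<sigma> (a i))", OF p \<epsilon> k] *
        by (simp add: w_eq signed_chamber_def)
    qed
    then show "w \<in> positive_minima_signed_permutations n"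
      using w by (simp add: w_eq positive_minima_signed_permutations_def)
  qed
qed

lemma bij_betw_bounded_regions:
  assumes l: "far_decreasing l"
  shows "bij_betw (\<lambda>w. signed_chamber w \<inter> slice l) (positive_minima_signed_permutations n)
    (bounded_regions (slice l) (restricted_arrangement type_B_arrangement (slice l)))"
proof (rule bij_betw_imageI)
  have sub: "positive_minima_signed_permutations n \<subseteq> signed_permutations n"
    by (auto simp: positive_minima_signed_permutations_def)
  show "inj_on (\<lambda>w. signed_chamber w \<inter> slice l) (positive_minima_signed_permutations n)"
  proof (rule inj_onI)
    fix w w' assume w: "w \<in> positive_minima_signed_permutations n"
      "w' \<in> positive_minima_signed_permutations n"
      and eq: "signed_chamber w \<inter> slice l = signed_chamber w' \<inter> slice l"
    obtain x where "x \<in> signed_chamber w \<inter> slice l"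
      using bounded_region_iff[OF l, of w] w(1) sub by blast
    then show "w = w'" using signed_chamber_unique[of w w' x] w sub eq by blast
  qed
  show "(\<lambda>w. signed_chamber w \<inter> slice l) ` positive_minima_signed_permutations n =
      bounded_regions (slice l) (restricted_arrangement type_B_arrangement (slice l))"
    unfolding bounded_regions_def regions_slice using bounded_region_iff[OF l] sub by blast
qed

end

section \<open>The common cardinality\<close>

theorem theorem11:
  fixes l :: "real ^ 'n::{finite,linorder}" and n :: nat
  assumes "n = CARD('n)" and "far_decreasing l"
  defines "S1 \<equiv> bounded_regions (slice l) (restricted_arrangement type_B_arrangement (slice l))"
    and "S2 \<equiv> positive_minima_signed_permutations n"
    and "S3 \<equiv> build_tree_codes n"
    and "S4 \<equiv> increasing_trees n"
  shows "finite S1 \<and> finite S2 \<and> finite S3 \<and> finite S4 \<and>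
         card S1 = card S2 \<and> card S2 = card S3 \<and> card S3 = card S4 \<and>
         card S4 = (\<Prod>i = 1..n. 2 * i - 1)"
proof -
  obtain e :: "nat \<Rightarrow> 'n" where e: "bij_betw e {1..n} UNIV" "strict_mono_on {1..n} e"
    using strict_mono_enumeration[of "UNIV :: 'n set"] assms(1) by auto
  have S1: "bij_betw (\<lambda>w. signed_chamber n e w \<inter> slice l) S2 S1"
    unfolding S1_def S2_def by (rule bij_betw_bounded_regions[OF e assms(2)])
  have S2: "finite S2" "card S2 = (\<Prod>i = 1..n. 2 * i - 1)"
    unfolding S2_def positive_minima_signed_permutations_eq
    using card_positive_minima_arrangements[of "{1..n}" n] by auto
  have S3: "finite S3" "card S3 = (\<Prod>i = 1..n. 2 * i - 1)"
    unfolding S3_def using card_build_tree_codes by auto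
  have S4: "finite S4" "card S4 = (\<Prod>i = 1..n. 2 * i - 1)"
    unfolding S4_def
    using card_increasing_forests bij_betw_finite[OF bij_betw_Node_0]
      bij_betw_same_card[OF bij_betw_Node_0] by auto
  show ?thesis
    using S2 S3 S4 bij_betw_finite[OF S1] bij_betw_same_card[OF S1] by simp
qed

end
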